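(* Let $P$ be a probability distribution on $\mathbb{C}^p$, let $\mathbf{x}\sim P$, and let $\mathbf{x}_1,\dots,\mathbf{x}_m$ be drawn independently from $P$. Let $\mathcal{A}$ be the set of feasible sampling patterns, let $g$ be an arbitrary decoder, and let $\eta$ be a performance measure normalized so that $\eta(\mathbf{x},\hat{\mathbf{x}})\in[0,1]$. For each $\Omega\in\mathcal{A}$ let $\eta_\Omega(\mathbf{x})=\eta(\mathbf{x},\hat{\mathbf{x}})$, where $\hat{\mathbf{x}}=g(\Omega,\mathbf{b})$ and $\mathbf{b}=\mathbf{P}_\Omega\boldsymbol{\Psi}\mathbf{x}$. Then for any $\delta\in(0,1)$, with probability at least $1-\delta$ (with respect to the randomness of $\mathbf{x}_1,\dots,\mathbf{x}_m$), it holds that $$\left|\frac{1}{m}\sum_{j=1}^m \eta_\Omega(\mathbf{x}_j)-\mathbb{E}_P\left[\eta_\Omega(\mathbf{x})\right]\right|\le\sqrt{\frac{1}{2m}\log\left(\frac{2|\mathcal{A}|}{\delta}\right)}$$ simultaneously for all $\Omega\in\mathcal{A}$.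
   Context: $\boldsymbol{\Psi}\in\mathbb{C}^{p\times p}$ is the Fourier transform matrix. For $\Omega\subseteq\{1,\dots,p\}$ with $|\Omega|=n$, $\mathbf{P}_\Omega:\mathbb{C}^p\to\mathbb{C}^n$ is the subsampling operator keeping the coordinates indexed by $\Omega$ (so $\mathbf{P}_\Omega\boldsymbol{\Psi}$ consists of the rows of $\boldsymbol{\Psi}$ indexed by $\Omega$). A decoder is an arbitrary (measurable, deterministic) function $g$ that maps a pair $(\Omega,\mathbf{b})$ with $\mathbf{b}\in\mathbb{C}^{|\Omega|}$ to an estimate $\hat{\mathbf{x}}=g(\Omega,\mathbf{b})\in\mathbb{C}^p$. A performance measure is a (measurable) real-valued function $\eta(\mathbf{x},\hat{\mathbf{x}})$ of a signal and its estimate. The feasible set $\mathcal{A}$ is a collection of subsets of $\{1,\dots,p\}$ (hence finite), given as follows: there is a set $\mathcal{S}$ of subsets of $\{1,\dots,p\}$, a cost function $c(\Omega)\ge 0$ that is monotone ($\Omega_1\subseteq\Omega_2$ implies $c(\Omega_1)\le c(\Omega_2)$), and a budget $\Gamma>0$; $\mathcal{A}$ consists of all $\Omega=\bigcup_{j=1}^{\ell}S_j$ with $\ell>0$, $S_j\in\mathcal{S}$, and $c(\Omega)\le\Gamma$. $\mathbb{E}_P$ denotes expectation over $\mathbf{x}\sim P$, and $\log$ is the natural logarithm. *)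

theory Defs
  imports "HOL-Probability.Probability"
begin

text \<open>
  The space of complex \<open>n\<close>-vectors, with coordinates indexed by \<open>{1..n}\<close> and equipped with its
  Borel \<open>\<sigma>\<close>-algebra.  Its points are the functions \<open>nat \<Rightarrow> complex\<close> that are \<open>undefined\<close>
  outside \<open>{1..n}\<close>, so equality of functions is equality of vectors.  (Only the measurable
  structure of this product is used.)
\<close>

abbreviation cvec :: "nat \<Rightarrow> (nat \<Rightarrow> complex) measure" where
  "cvec n \<equiv> Pi\<^sub>M {1..n} (\<lambda>_. borel)"

text \<open>
  The unitary normalisation \<open>1 / sqrt p\<close> is used.  Rows and columns are numbered from \<open>1\<close>,
  frequencies and positions from \<open>0\<close>, hence the shifts.
\<close>

definition fourier_matrix :: "nat \<Rightarrow> nat \<Rightarrow> nat \<Rightarrow> complex" where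
  "fourier_matrix p k l =
     exp (- 2 * of_real pi * \<i> * of_nat (k - 1) * of_nat (l - 1) / of_nat p) / of_real (sqrt (real p))"

definition fourier_transform :: "nat \<Rightarrow> (nat \<Rightarrow> complex) \<Rightarrow> (nat \<Rightarrow> complex)" where
  "fourier_transform p x = (\<lambda>k\<in>{1..p}. \<Sum>l=1..p. fourier_matrix p k l * x l)"

text \<open>
  The \<open>i\<close>-th coordinate of the subsampled vector is the coordinate of \<open>y\<close> at the \<open>i\<close>-th smallest
  element of \<open>\<Omega>\<close>; the shift is due to list positions being numbered from \<open>0\<close>.
\<close>

definition subsample :: "nat set \<Rightarrow> (nat \<Rightarrow> complex) \<Rightarrow> (nat \<Rightarrow> complex)" where
  "subsample \<Omega> y = (\<lambda>i\<in>{1..card \<Omega>}. y (sorted_list_of_set \<Omega> ! (i - 1)))"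

definition feasible_patterns :: "nat set set \<Rightarrow> (nat set \<Rightarrow> real) \<Rightarrow> real \<Rightarrow> nat set set" where
  "feasible_patterns \<S> c \<Gamma> =
     {\<Omega>. (\<exists>l>0. \<exists>S :: nat \<Rightarrow> nat set. (\<forall>j\<in>{1..l}. S j \<in> \<S>) \<and> \<Omega> = (\<Union>j\<in>{1..l}. S j)) \<and> c \<Omega> \<le> \<Gamma>}"

definition pattern_performance ::
    "nat \<Rightarrow> ((nat \<Rightarrow> complex) \<Rightarrow> (nat \<Rightarrow> complex) \<Rightarrow> real) \<Rightarrow>
     (nat set \<Rightarrow> (nat \<Rightarrow> complex) \<Rightarrow> (nat \<Rightarrow> complex)) \<Rightarrow>
     nat set \<Rightarrow> (nat \<Rightarrow> complex) \<Rightarrow> real" where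
  "pattern_performance p \<eta> g \<Omega> x = \<eta> x (g \<Omega> (subsample \<Omega> (fourier_transform p x)))"

end

theory Submission
  imports Defs
begin

text \<open>
  Hoeffding's inequality bounds the deviation probability of each single pattern by
  \<open>\<delta> / |\<A>|\<close>, and a union bound over the finite set \<open>\<A>\<close> makes the estimate simultaneous.
\<close>

text \<open>Composing with \<open>f\<close> preserves independence and common law, and the values
  stay in an interval of length 1, so Hoeffding's inequality for i.i.d. variables applies. The
  result centres at the integral against the law \<open>D\<close>, so no sample variable occurs in
  the mean.\<close>

lemma (in prob_space) hoeffding_empirical_mean:
  fixes f :: "'b \<Rightarrow> real" and X :: "'i \<Rightarrow> 'a \<Rightarrow> 'b"
  assumes fin: "finite I" and ne: "I \<noteq> {}"
    and indep: "indep_vars (\<lambda>_. N) X I"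
    and distr: "\<And>i. i \<in> I \<Longrightarrow> distr M N (X i) = D"
    and f [measurable]: "f \<in> borel_measurable N"
    and range: "\<And>x. x \<in> space N \<Longrightarrow> f x \<in> {0..1}"
    and \<epsilon>: "\<epsilon> \<ge> 0"
  shows "prob {\<omega> \<in> space M. \<bar>(\<Sum>i\<in>I. f (X i \<omega>)) / real (card I) - (\<integral>x. f x \<partial>D)\<bar> \<ge> \<epsilon>}
           \<le> 2 * exp (- 2 * real (card I) * \<epsilon>\<^sup>2)"
proof -
  \<comment> \<open>Any index can serve as representative: the Hoeffding locale expresses the common
    law and its mean through a single random variable.\<close>
  from ne obtain k where k: "k \<in> I"
    by blast
  have X: "X i \<in> measurable M N" if "i \<in> I" for i
    using indep that unfolding indep_vars_def by blast
  have distr_f: "distr M borel (\<lambda>\<omega>. f (X i \<omega>)) = distr D borel f" if "i \<in> I" for i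
    unfolding distr[OF that, symmetric] using X[OF that]
    by (subst distr_distr) (simp_all add: o_def)
  have mean: "(\<integral>x. f x \<partial>D) = expectation (\<lambda>\<omega>. f (X k \<omega>))"
    unfolding distr[OF k, symmetric] by (rule integral_distr) (use X[OF k] in simp_all)
  interpret H: Hoeffding_ineq_iid M I "\<lambda>i \<omega>. f (X i \<omega>)" "\<lambda>\<omega>. f (X k \<omega>)" 0 1 "\<integral>x. f x \<partial>D"
  proof unfold_locales
    show "indep_vars (\<lambda>_. borel) (\<lambda>i \<omega>. f (X i \<omega>)) I"
      by (rule indep_vars_compose2[OF indep]) simp
    show "distr M borel (\<lambda>\<omega>. f (X i \<omega>)) = distr M borel (\<lambda>\<omega>. f (X k \<omega>))" if "i \<in> I" for i
      using distr_f k that by simp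
    show "random_variable borel (\<lambda>\<omega>. f (X k \<omega>))"
      using X[OF k] by measurable
    show "AE \<omega> in M. f (X k \<omega>) \<in> {0..1}"
      using measurable_space[OF X[OF k]] range by (intro AE_I2) blast
    show "(\<integral>x. f x \<partial>D) \<equiv> expectation (\<lambda>\<omega>. f (X k \<omega>))"
      by (rule eq_reflection) (rule mean)
  qed (rule fin)
  show ?thesis
    using H.Hoeffding_ineq_abs_ge'[OF \<epsilon> zero_less_one ne] by simp
qed

text \<open>Stated for an abstract finite family \<open>F\<close>, free of Fourier sampling; the
  family of performances of the feasible patterns is substituted later.\<close>

lemma (in prob_space) hoeffding_empirical_mean_uniform:
  fixes F :: "'c \<Rightarrow> 'b \<Rightarrow> real" and X :: "'i \<Rightarrow> 'a \<Rightarrow> 'b"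
  assumes fin: "finite I" and ne: "I \<noteq> {}" and finA: "finite A"
    and indep: "indep_vars (\<lambda>_. N) X I"
    and distr: "\<And>i. i \<in> I \<Longrightarrow> distr M N (X i) = D"
    and F: "\<And>a. a \<in> A \<Longrightarrow> F a \<in> borel_measurable N"
    and range: "\<And>a x. a \<in> A \<Longrightarrow> x \<in> space N \<Longrightarrow> F a x \<in> {0..1}"
    and \<delta>: "\<delta> \<in> {0<..1}"
  shows "prob {\<omega> \<in> space M. \<forall>a\<in>A. \<bar>(\<Sum>i\<in>I. F a (X i \<omega>)) / real (card I) - (\<integral>x. F a x \<partial>D)\<bar>
           \<le> sqrt (1 / (2 * real (card I)) * ln (2 * real (card A) / \<delta>))} \<ge> 1 - \<delta>"
\<comment> \<open>For empty \<open>A\<close> the event is the whole space. Otherwise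
  \<open>card A\<close> is at least 1, which the logarithm and the division of
  \<open>\<delta>\<close> below rely on.\<close>
proof (cases "A = {}")
  case True
  then show ?thesis
    using \<delta> by (simp add: prob_space)
next
  case False
  define \<epsilon> where "\<epsilon> = sqrt (1 / (2 * real (card I)) * ln (2 * real (card A) / \<delta>))"
  define dev where "dev a \<omega> = \<bar>(\<Sum>i\<in>I. F a (X i \<omega>)) / real (card I) - (\<integral>x. F a x \<partial>D)\<bar>" for a \<omega>
  \<comment> \<open>The inequality is non-strict to match the event in Hoeffding's bound.\<close>
  define bad where "bad a = {\<omega> \<in> space M. dev a \<omega> \<ge> \<epsilon>}" for a
  have cardA: "card A \<ge> 1" and cardI: "card I > 0"
    using False ne fin finA by (simp_all add: Suc_le_eq card_gt_0_iff)
  have X: "X i \<in> measurable M N" if "i \<in> I" for i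
    using indep that unfolding indep_vars_def by blast
  have dev_meas: "dev a \<in> borel_measurable M" if "a \<in> A" for a
    unfolding dev_def
    by (intro borel_measurable_abs borel_measurable_diff borel_measurable_divide
        borel_measurable_sum borel_measurable_const measurable_compose[OF X F[OF that]])
  have bad_sets: "bad a \<in> sets M" if "a \<in> A" for a
    using dev_meas[OF that] unfolding bad_def by measurable
  have good_sets: "{\<omega> \<in> space M. \<forall>a\<in>A. dev a \<omega> \<le> \<epsilon>} \<in> sets M"
    by (intro sets.sets_Collect_finite_All finA borel_measurable_le dev_meas borel_measurable_const)
  \<comment> \<open>This makes the logarithm nonnegative, so that squaring \<open>\<epsilon>\<close>
    undoes the root; the root of a negative real is negative in HOL, which would violate
    \<open>\<epsilon> \<ge> 0\<close>.\<close>
  have ratio: "1 \<le> 2 * real (card A) / \<delta>"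
    using cardA \<delta> by (simp add: field_simps)
  then have ln_nonneg: "0 \<le> ln (2 * real (card A) / \<delta>)"
    by (rule ln_ge_zero)
  then have \<epsilon>: "\<epsilon> \<ge> 0" and "2 * real (card I) * \<epsilon>\<^sup>2 = ln (2 * real (card A) / \<delta>)"
    unfolding \<epsilon>_def using cardI by simp_all
  \<comment> \<open>The exponent is minus the logarithm of \<open>2 * card A / \<delta>\<close>, so
    the factor 2 of the two-sided bound cancels.\<close>
  then have tail: "2 * exp (- 2 * real (card I) * \<epsilon>\<^sup>2) = \<delta> / real (card A)"
    using ratio \<delta> cardA by (simp add: exp_minus field_simps)
  have "prob (\<Union>a\<in>A. bad a) \<le> (\<Sum>a\<in>A. prob (bad a))"
    using finA bad_sets by (intro finite_measure_subadditive_finite) auto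
  also have "\<dots> \<le> (\<Sum>a\<in>A. \<delta> / real (card A))"
    unfolding tail[symmetric] bad_def dev_def
    by (intro sum_mono hoeffding_empirical_mean[OF fin ne indep distr] F range \<epsilon>)
  also have "\<dots> = \<delta>"
    using cardA by simp
  finally have "1 - \<delta> \<le> prob (space M - (\<Union>a\<in>A. bad a))"
    using finA bad_sets by (subst prob_compl) auto
  \<comment> \<open>Outside all bad events every deviation is strictly below
    \<open>\<epsilon>\<close>, hence only an inclusion of events.\<close>
  also have "\<dots> \<le> prob {\<omega> \<in> space M. \<forall>a\<in>A. dev a \<omega> \<le> \<epsilon>}"
    by (intro finite_measure_mono good_sets) (auto simp: bad_def)
  finally show ?thesis
    unfolding dev_def \<epsilon>_def .
qed

lemma fourier_transform_measurable: "fourier_transform p \<in> measurable (cvec p) (cvec p)"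
  unfolding fourier_transform_def
  by (intro measurable_restrict borel_measurable_sum borel_measurable_times
      borel_measurable_const measurable_component_singleton)

text \<open>Each output coordinate is a projection of the input, to an index lying in
  \<open>{1..p}\<close> because it is an element of \<open>\<Omega>\<close>.\<close>

lemma subsample_measurable:
  assumes "\<Omega> \<subseteq> {1..p}"
  shows "subsample \<Omega> \<in> measurable (cvec p) (cvec (card \<Omega>))"
  unfolding subsample_def
proof (intro measurable_restrict measurable_component_singleton)
  have "finite \<Omega>"
    using assms by (rule finite_subset) simp
  \<comment> \<open>As \<open>i\<close> starts at 1, \<open>i - 1\<close> is not truncated and stays
    below the list length \<open>card \<Omega>\<close>.\<close>
  then have "sorted_list_of_set \<Omega> ! (i - 1) \<in> \<Omega>" if "i \<in> {1..card \<Omega>}" for i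
    using that nth_mem[of "i - 1" "sorted_list_of_set \<Omega>"] by fastforce
  then show "sorted_list_of_set \<Omega> ! (i - 1) \<in> {1..p}" if "i \<in> {1..card \<Omega>}" for i
    using assms that by blast
qed

text \<open>With \<open>U = {1..p}\<close> this yields both the finiteness of \<open>\<A>\<close>
  for the union bound and the coordinate range needed for measurability.\<close>

lemma feasible_patterns_subset:
  assumes "\<S> \<subseteq> Pow U"
  shows "feasible_patterns \<S> c \<Gamma> \<subseteq> Pow U"
  using assms unfolding feasible_patterns_def by blast

theorem proposition1:
  fixes p m :: nat
    and P :: "(nat \<Rightarrow> complex) measure"
    and M :: "'w measure"
    and X :: "nat \<Rightarrow> 'w \<Rightarrow> (nat \<Rightarrow> complex)"
    and \<S> :: "nat set set" and c :: "nat set \<Rightarrow> real" and \<Gamma> :: real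
    and \<A> :: "nat set set"
    and g :: "nat set \<Rightarrow> (nat \<Rightarrow> complex) \<Rightarrow> (nat \<Rightarrow> complex)"
    and \<eta> :: "(nat \<Rightarrow> complex) \<Rightarrow> (nat \<Rightarrow> complex) \<Rightarrow> real"
    and \<delta> :: real
  assumes p_pos: "p \<ge> 1" and m_pos: "m \<ge> 1"
    and P_prob: "prob_space P" and P_sets: "sets P = sets (cvec p)"
    and M_prob: "prob_space M"
    and X_indep: "prob_space.indep_vars M (\<lambda>_. cvec p) X {1..m}"
    and X_distr: "\<And>j. j \<in> {1..m} \<Longrightarrow> distr M (cvec p) (X j) = P"
    and S_sub: "\<S> \<subseteq> Pow {1..p}"
    and c_nonneg: "\<And>\<Omega>. \<Omega> \<subseteq> {1..p} \<Longrightarrow> c \<Omega> \<ge> 0"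
    and c_mono: "\<And>\<Omega>1 \<Omega>2. \<Omega>1 \<subseteq> \<Omega>2 \<Longrightarrow> \<Omega>2 \<subseteq> {1..p} \<Longrightarrow> c \<Omega>1 \<le> c \<Omega>2"
    and Gamma_pos: "\<Gamma> > 0"
    and A_eq: "\<A> = feasible_patterns \<S> c \<Gamma>"
    and g_meas: "\<And>\<Omega>. \<Omega> \<subseteq> {1..p} \<Longrightarrow> g \<Omega> \<in> measurable (cvec (card \<Omega>)) (cvec p)"
    and eta_meas: "(\<lambda>(x, xh). \<eta> x xh) \<in> borel_measurable (cvec p \<Otimes>\<^sub>M cvec p)"
    and eta_range: "\<And>x xh. x \<in> space (cvec p) \<Longrightarrow> xh \<in> space (cvec p) \<Longrightarrow> \<eta> x xh \<in> {0..1}"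
    and delta: "\<delta> \<in> {0<..<1}"
  shows "measure M {\<omega> \<in> space M. \<forall>\<Omega>\<in>\<A>.
           \<bar>(1 / real m) * (\<Sum>j=1..m. pattern_performance p \<eta> g \<Omega> (X j \<omega>))
              - (\<integral>x. pattern_performance p \<eta> g \<Omega> x \<partial>P)\<bar>
           \<le> sqrt (1 / (2 * real m) * ln (2 * real (card \<A>) / \<delta>))} \<ge> 1 - \<delta>"
proof -
  interpret prob_space M
    by (rule M_prob)
  have sub: "\<A> \<subseteq> Pow {1..p}"
    unfolding A_eq using S_sub by (rule feasible_patterns_subset)
  have estimate: "(\<lambda>x. g \<Omega> (subsample \<Omega> (fourier_transform p x))) \<in> measurable (cvec p) (cvec p)"
    if "\<Omega> \<in> \<A>" for \<Omega>
  proof -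
    have "\<Omega> \<subseteq> {1..p}"
      using sub that by blast
    then show ?thesis
      by (intro measurable_compose[OF fourier_transform_measurable]
          measurable_compose[OF subsample_measurable] g_meas)
  qed
  have "prob {\<omega> \<in> space M. \<forall>\<Omega>\<in>\<A>.
          \<bar>(\<Sum>j\<in>{1..m}. pattern_performance p \<eta> g \<Omega> (X j \<omega>)) / real (card {1..m})
             - (\<integral>x. pattern_performance p \<eta> g \<Omega> x \<partial>P)\<bar>
          \<le> sqrt (1 / (2 * real (card {1..m})) * ln (2 * real (card \<A>) / \<delta>))} \<ge> 1 - \<delta>"
  proof (rule hoeffding_empirical_mean_uniform[OF _ _ _ X_indep X_distr])
    show "finite \<A>"
      using sub by (rule finite_subset) simp
    show "pattern_performance p \<eta> g \<Omega> \<in> borel_measurable (cvec p)" if "\<Omega> \<in> \<A>" for \<Omega>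
      \<comment> \<open>The performance is the jointly measurable \<open>\<eta>\<close> after the
        map sending a signal to the pair of itself and its estimate.\<close>
      using measurable_compose[OF measurable_Pair[OF measurable_ident_sets[OF refl] estimate[OF that]] eta_meas]
      by (simp add: pattern_performance_def[abs_def])
    show "pattern_performance p \<eta> g \<Omega> x \<in> {0..1}" if "\<Omega> \<in> \<A>" "x \<in> space (cvec p)" for \<Omega> x
      unfolding pattern_performance_def
      \<comment> \<open>The bound on \<open>\<eta>\<close> holds for points of the space only, so
        the estimate must be shown to lie there.\<close>
      using that measurable_space[OF estimate] by (intro eta_range)
  qed (use m_pos delta in auto)
  then show ?thesis
    by simp
qed

end
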